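(* Let $G=G([n],E)$ be a simple connected graph. Then the ideals $A_G$ and $T_G$ are Alexander dual to each other with respect to $\mathbf{d}_G+\mathbf{1}$, i.e. $A_G^{[\mathbf{d}_G+\mathbf{1}]}=T_G$ and $T_G^{[\mathbf{d}_G+\mathbf{1}]}=A_G$.
   Context: Work in $S=\mathbf{k}[x_1,\dots,x_n]$, $\mathbf{k}$ an infinite field; $\mathbf{x}^{\mathbf{a}}=\prod_i x_i^{a_i}$. $\mathbf{d}_G\in\mathbb{N}^{[n]}$ is the degree vector of $G$, $\mathbf{1}=(1,\dots,1)$, and $\mathbf{1}_\sigma=\sum_{i\in\sigma}e_i$. For an acyclic orientation $O$ of $G$ (every edge oriented, no directed cycle), $\mathrm{indeg}_O(i)$ is the number of edges directed into $i$. $A_G$ is the monomial ideal generated by $\prod_{i}x_i^{\mathrm{indeg}_O(i)+1}$ over all acyclic orientations $O$ of $G$. For $\sigma\subseteq[n]$ and $i\in\sigma$, let $\mathrm{deg}^{\mathrm{out}}_\sigma(i)=|\{j\in[n]\setminus\sigma:\{i,j\}\in E\}|$. $T_G$ is the monomial ideal generated by $\prod_{i\in\sigma}x_i^{\mathrm{deg}^{\mathrm{out}}_\sigma(i)+1}$ over all nonempty $\sigma\subseteq[n]$ with $G[\sigma]$ connected. For $\mathbf{b}\in\mathbb{N}^{[n]}$ let $\mathfrak{m}^{\mathbf{b}}=\langle x_i^{b_i}: b_i\ge1\rangle$. For $\mathbf{b}\preceq\mathbf{a}$ coordinatewise, $\mathbf{a}\setminus\mathbf{b}$ has $i$-th coordinate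 $a_i+1-b_i$ if $b_i\ge1$ and $0$ if $b_i=0$. If all minimal generators of a monomial ideal $I$ divide $\mathbf{x}^{\mathbf{a}}$, its Alexander dual with respect to $\mathbf{a}$ is $I^{[\mathbf{a}]}=\bigcap\{\mathfrak{m}^{\mathbf{a}\setminus\mathbf{b}}:\mathbf{x}^{\mathbf{b}}\text{ a minimal generator of }I\}$. *)

theory Defs
  imports Complex_Main "HOL-Library.Poly_Mapping"
begin

text \<open>
  The vertex set (and index set of the variables) \<open>[n]\<close> is the universe of a finite type \<open>'n\<close>,
  so \<open>n = CARD('n)\<close>. The polynomial ring \<open>\<^bold>k[x\<^sub>1, \<dots>, x\<^sub>n]\<close> consists of the finitely supported
  functions from exponents to coefficients, with the convolution product of
  \<open>HOL-Library.Poly_Mapping\<close>. Exponent vectors outside the ring are plain functions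
  \<open>'n \<Rightarrow> nat\<close>, so that \<open>\<le>\<close> on them is the coordinatewise order.
\<close>

type_synonym ('n, 'k) polyring = "('n \<Rightarrow>\<^sub>0 nat) \<Rightarrow>\<^sub>0 'k"

definition var :: "'n::finite \<Rightarrow> ('n, 'k::field) polyring" where
  "var i = Poly_Mapping.single (Poly_Mapping.single i 1) 1"

definition monom_of :: "('n::finite \<Rightarrow> nat) \<Rightarrow> ('n, 'k::field) polyring" where
  "monom_of a = (\<Prod>i\<in>UNIV. var i ^ a i)"

text \<open>An ideal is a submodule of the ring regarded as a module over itself.\<close>

definition ideal_gen :: "'a::comm_ring_1 set \<Rightarrow> 'a set" where
  "ideal_gen B = module.span (*) B"

definition monomial_ideal :: "('n::finite \<Rightarrow> nat) set \<Rightarrow> ('n, 'k::field) polyring set" where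
  "monomial_ideal B = ideal_gen (monom_of ` B)"

text \<open>
  The exponents \<open>b\<close> such that \<open>x\<^sup>b\<close> is a minimal generator of \<open>I\<close>, i.e. belongs to an
  inclusion-minimal set of monomials generating \<open>I\<close>; for a monomial ideal there is exactly
  one such set.
\<close>

definition minimal_generating :: "('n::finite, 'k::field) polyring set \<Rightarrow> ('n \<Rightarrow> nat) set \<Rightarrow> bool" where
  "minimal_generating I B \<longleftrightarrow>
     I = monomial_ideal B \<and> (\<forall>C. C \<subset> B \<longrightarrow> I \<noteq> monomial_ideal C)"

definition min_gens :: "('n::finite, 'k::field) polyring set \<Rightarrow> ('n \<Rightarrow> nat) set" where
  "min_gens I = \<Union>{B. minimal_generating I B}"

definition irred_ideal :: "('n::finite \<Rightarrow> nat) \<Rightarrow> ('n, 'k::field) polyring set" where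
  "irred_ideal b = ideal_gen {var i ^ b i | i. b i \<ge> 1}"

text \<open>
  The vector \<open>a \<setminus> b\<close>, meaningful for \<open>b \<le> a\<close>; the subtraction then does not truncate.
\<close>

definition exp_compl :: "('n \<Rightarrow> nat) \<Rightarrow> ('n \<Rightarrow> nat) \<Rightarrow> 'n \<Rightarrow> nat" where
  "exp_compl a b = (\<lambda>i. if b i \<ge> 1 then a i + 1 - b i else 0)"

definition gens_divide :: "('n::finite, 'k::field) polyring set \<Rightarrow> ('n \<Rightarrow> nat) \<Rightarrow> bool" where
  "gens_divide I a \<longleftrightarrow>
     (\<forall>b\<in>min_gens I. (monom_of b :: ('n, 'k) polyring) dvd monom_of a)"

text \<open>The Alexander dual \<open>I\<^bsup>[a]\<^esup>\<close>, meaningful only if \<open>gens_divide I a\<close> holds.\<close>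

definition alexander_dual ::
  "('n::finite, 'k::field) polyring set \<Rightarrow> ('n \<Rightarrow> nat) \<Rightarrow> ('n, 'k) polyring set" where
  "alexander_dual I a = (\<Inter>b\<in>min_gens I. irred_ideal (exp_compl a b))"

definition simple_graph :: "'v set \<Rightarrow> 'v set set \<Rightarrow> bool" where
  "simple_graph V E \<longleftrightarrow> finite V \<and> (\<forall>e\<in>E. e \<subseteq> V \<and> card e = 2)"

definition connected_graph :: "'v set \<Rightarrow> 'v set set \<Rightarrow> bool" where
  "connected_graph V E \<longleftrightarrow> V \<noteq> {} \<and> (\<forall>u\<in>V. \<forall>v\<in>V. (u, v) \<in> {(i, j). {i, j} \<in> E}\<^sup>*)"

definition induced_edges :: "'v set set \<Rightarrow> 'v set \<Rightarrow> 'v set set" where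
  "induced_edges E \<sigma> = {e\<in>E. e \<subseteq> \<sigma>}"

definition degree_vec :: "'v set set \<Rightarrow> 'v \<Rightarrow> nat" where
  "degree_vec E i = card {e\<in>E. i \<in> e}"

text \<open>
  An orientation chooses exactly one of \<open>(i, j)\<close>, \<open>(j, i)\<close> for every edge \<open>{i, j}\<close>;
  \<open>(i, j)\<close> means that the edge points from \<open>i\<close> to \<open>j\<close>.
\<close>

definition orientation :: "'v set set \<Rightarrow> ('v \<times> 'v) set \<Rightarrow> bool" where
  "orientation E D \<longleftrightarrow>
     (\<forall>(i, j)\<in>D. {i, j} \<in> E) \<and>
     (\<forall>i j. {i, j} \<in> E \<longrightarrow> ((i, j) \<in> D \<longleftrightarrow> (j, i) \<notin> D))"

definition indeg :: "('v \<times> 'v) set \<Rightarrow> 'v \<Rightarrow> nat" where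
  "indeg D i = card {d\<in>D. snd d = i}"

definition A_ideal :: "'n::finite set set \<Rightarrow> ('n, 'k::field) polyring set" where
  "A_ideal E = monomial_ideal {\<lambda>i. indeg D i + 1 | D. orientation E D \<and> acyclic D}"

definition deg_out :: "'v set set \<Rightarrow> 'v set \<Rightarrow> 'v \<Rightarrow> nat" where
  "deg_out E \<sigma> i = card {j. j \<notin> \<sigma> \<and> {i, j} \<in> E}"

definition T_ideal :: "'n::finite set set \<Rightarrow> ('n, 'k::field) polyring set" where
  "T_ideal E = monomial_ideal
     {\<lambda>i. if i \<in> \<sigma> then deg_out E \<sigma> i + 1 else 0 | \<sigma>.
        \<sigma> \<noteq> {} \<and> connected_graph \<sigma> (induced_edges E \<sigma>)}"

end

theory Submission
  imports Defs
begin

text \<open>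
  A polynomial lies in a monomial ideal iff each of its exponents lies in the up-set of the
  generating exponents, so both dualities are statements about exponent vectors \<open>u\<close>:
  \<open>u\<close> lies above a generator of \<open>T\<^sub>G\<close> iff every acyclic orientation has a vertex with outdegree
  less than \<open>u i\<close>, and \<open>u\<close> lies above a generator of \<open>A\<^sub>G\<close> iff every connected \<open>\<sigma>\<close> has a
  vertex with fewer than \<open>u i\<close> neighbours in \<open>\<sigma>\<close>. In one direction, look at a sink of the
  orientation restricted to \<open>\<sigma>\<close>. In the other, remove the vertices one at a time, each time a
  vertex that is good for the set \<open>\<sigma>\<close> of vertices still present, and orient every edge towards
  the endpoint removed first.
\<close>

section \<open>Monomial ideals\<close>

text \<open>The exponents of the monomials in the ideal generated by \<open>B\<close>; a monomial
  ideal is determined by this set.\<close>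

definition up_set :: "('n \<Rightarrow> nat) set \<Rightarrow> ('n \<Rightarrow> nat) set" where
  "up_set B = {u. \<exists>b\<in>B. b \<le> u}"

interpretation ring_module: module "(*) :: 'a::comm_ring_1 \<Rightarrow> 'a \<Rightarrow> 'a"
  by unfold_locales (auto simp: algebra_simps)

lemma lookup_Abs_poly_mapping_finite [simp]:
  "Poly_Mapping.lookup (Abs_poly_mapping a) = (a :: 'n::finite \<Rightarrow> nat)"
  by (rule Abs_poly_mapping_inverse) simp

lemma var_power:
  "(var i ^ k :: ('n::finite, 'k::field) polyring) = Poly_Mapping.single (Poly_Mapping.single i k) 1"
  by (induction k) (simp_all add: var_def mult_single flip: single_add)

lemma prod_single:
  "finite A \<Longrightarrow> (\<Prod>i\<in>A. Poly_Mapping.single (f i) (1::'k::comm_semiring_1))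
     = Poly_Mapping.single (\<Sum>i\<in>A. (f i :: 'm::comm_monoid_add)) 1"
  by (induction A rule: finite_induct) (simp_all add: mult_single)

lemma monom_of_eq_single:
  "(monom_of a :: ('n::finite, 'k::field) polyring) = Poly_Mapping.single (Abs_poly_mapping a) 1"
proof -
  have "(\<Sum>i\<in>UNIV. Poly_Mapping.single i (a i)) = Abs_poly_mapping a"
    by (rule poly_mapping_eqI) (simp add: lookup_sum lookup_single when_def)
  then show ?thesis
    by (simp add: monom_of_def var_power prod_single)
qed

lemma monom_of_dvd:
  assumes "b \<le> a"
  shows "(monom_of b :: ('n::finite, 'k::field) polyring) dvd monom_of a"
  unfolding monom_of_def using assms
  by (intro prod_dvd_prod le_imp_power_dvd) (auto simp: le_fun_def)

lemma sum_single_lookup: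
  "(\<Sum>m\<in>Poly_Mapping.keys p. Poly_Mapping.single m (Poly_Mapping.lookup p m)) = p"
  by (rule poly_mapping_eqI)
    (simp add: lookup_sum lookup_single when_def in_keys_iff)

text \<open>Forwards, induct over the span: multiplying \<open>monom_of b\<close> by any polynomial
  gives only exponents above \<open>b\<close>, and adding polynomials creates no new exponents.
  Backwards, each term of \<open>p\<close> is a multiple of some generator, and \<open>p\<close> is
  the sum of its terms.\<close>

lemma mem_monomial_ideal_iff:
  fixes p :: "('n::finite, 'k::field) polyring"
  shows "p \<in> monomial_ideal B \<longleftrightarrow> (\<forall>m\<in>Poly_Mapping.keys p. Poly_Mapping.lookup m \<in> up_set B)"
proof
  assume "p \<in> monomial_ideal B"
  then have "p \<in> ring_module.span (monom_of ` B)"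
    by (simp add: monomial_ideal_def ideal_gen_def)
  then show "\<forall>m\<in>Poly_Mapping.keys p. Poly_Mapping.lookup m \<in> up_set B"
  proof (induction rule: ring_module.span_induct_alt)
    case base
    then show ?case by simp
  next
    case (step c x y)
    then obtain b where b: "b \<in> B" "x = monom_of b" by blast
    show ?case
    proof
      fix m assume "m \<in> Poly_Mapping.keys (c * x + y)"
      then consider "m \<in> Poly_Mapping.keys (c * x)" | "m \<in> Poly_Mapping.keys y"
        using keys_add[of "c * x" y] by blast
      then show "Poly_Mapping.lookup m \<in> up_set B"
      proof cases
        case 1
        then obtain k where "m = k + Abs_poly_mapping b"
          using keys_mult[of c x] by (auto simp: b monom_of_eq_single)
        then show ?thesis
          using b by (auto simp: up_set_def le_fun_def lookup_add intro!: bexI[of _ b])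
      next
        case 2
        then show ?thesis using step by blast
      qed
    qed
  qed
next
  assume *: "\<forall>m\<in>Poly_Mapping.keys p. Poly_Mapping.lookup m \<in> up_set B"
  have "Poly_Mapping.single m (Poly_Mapping.lookup p m) \<in> ring_module.span (monom_of ` B)"
    if m: "m \<in> Poly_Mapping.keys p" for m
  proof -
    obtain b where b: "b \<in> B" "b \<le> Poly_Mapping.lookup m"
      using * m by (auto simp: up_set_def)
    \<comment> \<open>The quotient of the two monomials; the subtraction does not truncate because
      \<open>b\<close> lies below the exponent \<open>m\<close>.\<close>
    have "m = Abs_poly_mapping (\<lambda>i. Poly_Mapping.lookup m i - b i) + Abs_poly_mapping b"
      using b(2) by (intro poly_mapping_eqI) (simp add: lookup_add le_fun_def)
    then have "Poly_Mapping.single m (Poly_Mapping.lookup p m) =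
      Poly_Mapping.single (Abs_poly_mapping (\<lambda>i. Poly_Mapping.lookup m i - b i))
        (Poly_Mapping.lookup p m) * monom_of b"
      by (simp add: monom_of_eq_single mult_single)
    then show ?thesis
      using b(1) by (simp add: ring_module.span_base ring_module.span_scale)
  qed
  then have "p \<in> ring_module.span (monom_of ` B)"
    by (subst sum_single_lookup[symmetric]) (rule ring_module.span_sum)
  then show "p \<in> monomial_ideal B"
    by (simp add: monomial_ideal_def ideal_gen_def)
qed

lemma monomial_ideal_eq_iff:
  "(monomial_ideal B :: ('n::finite, 'k::field) polyring set) = monomial_ideal C \<longleftrightarrow> up_set B = up_set C"
proof
  assume *: "(monomial_ideal B :: ('n, 'k) polyring set) = monomial_ideal C"
  have "u \<in> up_set D \<longleftrightarrow> (monom_of u :: ('n, 'k) polyring) \<in> monomial_ideal D" for u D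
    by (simp add: mem_monomial_ideal_iff monom_of_eq_single)
  with * show "up_set B = up_set C" by blast
next
  assume "up_set B = up_set C"
  then show "(monomial_ideal B :: ('n, 'k) polyring set) = monomial_ideal C"
    by (auto simp: mem_monomial_ideal_iff)
qed

section \<open>Minimal generators and Alexander duals\<close>

definition minimal_exponents :: "('n \<Rightarrow> nat) set \<Rightarrow> ('n \<Rightarrow> nat) set" where
  "minimal_exponents B = {b\<in>B. \<forall>c\<in>B. c \<le> b \<longrightarrow> c = b}"

text \<open>Descent on the total degree: a strictly smaller exponent vector has a strictly smaller
  coordinate sum. This also covers infinite \<open>B\<close>.\<close>

lemma minimal_exponents_below:
  fixes b :: "'n::finite \<Rightarrow> nat"
  assumes "b \<in> B"
  shows "\<exists>c\<in>minimal_exponents B. c \<le> b"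
  using assms
proof (induction "sum b UNIV" arbitrary: b rule: less_induct)
  case less
  show ?case
  proof (cases "b \<in> minimal_exponents B")
    case False
    then obtain c where c: "c \<in> B" "c \<le> b" "c \<noteq> b"
      using less.prems by (auto simp: minimal_exponents_def)
    then obtain i where "c i < b i"
      by (metis ext le_fun_def le_neq_implies_less)
    then have "sum c UNIV < sum b UNIV"
      using c(2) by (intro sum_strict_mono_ex1) (auto simp: le_fun_def)
    then show ?thesis
      using less.hyps c by (meson order_trans)
  qed auto
qed

lemma up_set_minimal_exponents:
  "up_set (minimal_exponents B) = up_set (B :: ('n::finite \<Rightarrow> nat) set)"
proof
  show "up_set (minimal_exponents B) \<subseteq> up_set B"
    by (auto simp: up_set_def minimal_exponents_def)
  show "up_set B \<subseteq> up_set (minimal_exponents B)"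
    unfolding up_set_def using minimal_exponents_below by (blast intro: order_trans)
qed

text \<open>The minimal exponents can be read off the up-set, so they depend on the ideal alone and
  not on the chosen generators.\<close>

lemma minimal_exponents_up_set: "minimal_exponents (up_set B) = minimal_exponents B"
proof (intro equalityI subsetI)
  have sub: "B \<subseteq> up_set B" by (auto simp: up_set_def)
  fix b assume b: "b \<in> minimal_exponents (up_set B)"
  then obtain c where c: "c \<in> B" "c \<le> b" by (auto simp: minimal_exponents_def up_set_def)
  then have "c = b" using b sub by (auto simp: minimal_exponents_def)
  then show "b \<in> minimal_exponents B"
    using b c(1) sub by (auto simp: minimal_exponents_def)
next
  fix b assume b: "b \<in> minimal_exponents B"
  have "c = b" if "c \<in> up_set B" "c \<le> b" for c
  proof -
    obtain d where d: "d \<in> B" "d \<le> c" using \<open>c \<in> up_set B\<close> by (auto simp: up_set_def)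
    then have "d \<le> b" using \<open>c \<le> b\<close> by (meson order_trans)
    then have "d = b" using b d(1) by (simp add: minimal_exponents_def)
    then show ?thesis using d(2) \<open>c \<le> b\<close> by simp
  qed
  moreover have "b \<in> up_set B" using b by (auto simp: minimal_exponents_def up_set_def)
  ultimately show "b \<in> minimal_exponents (up_set B)" by (simp add: minimal_exponents_def)
qed

text \<open>The union in \<open>min_gens\<close> ranges over exactly one set. The minimal exponents
  generate, and leaving out one of them loses its monomial. Conversely, an irredundant generating
  set \<open>C\<close> equals its own set of minimal exponents, which the common up-set
  determines.\<close>

lemma min_gens_monomial_ideal:
  "min_gens (monomial_ideal B :: ('n::finite, 'k::field) polyring set) = minimal_exponents B"
proof -
  let ?I = "monomial_ideal B :: ('n, 'k) polyring set"
  have "minimal_generating ?I (minimal_exponents B)"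
    unfolding minimal_generating_def monomial_ideal_eq_iff
  proof (intro conjI allI impI)
    show "up_set B = up_set (minimal_exponents B)"
      by (simp add: up_set_minimal_exponents)
    fix C assume C: "C \<subset> minimal_exponents B"
    then obtain b where b: "b \<in> minimal_exponents B" "b \<notin> C" by blast
    have "b \<in> B" using b(1) by (simp add: minimal_exponents_def)
    then have "b \<in> up_set B" by (auto simp: up_set_def)
    moreover have "b \<notin> up_set C"
    proof
      assume "b \<in> up_set C"
      then obtain c where c: "c \<in> C" "c \<le> b" by (auto simp: up_set_def)
      then have "c \<in> B" using C by (auto simp: minimal_exponents_def)
      then have "c = b" using b(1) c(2) by (simp add: minimal_exponents_def)
      then show False using b(2) c(1) by simp
    qed
    ultimately show "up_set B \<noteq> up_set C" by blast
  qed
  moreover have "C = minimal_exponents B" if "minimal_generating ?I C" for C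
  proof -
    have eq: "up_set C = up_set B" and min: "\<forall>D. D \<subset> C \<longrightarrow> up_set B \<noteq> up_set D"
      using that unfolding minimal_generating_def monomial_ideal_eq_iff by blast+
    have "minimal_exponents C \<subseteq> C" by (auto simp: minimal_exponents_def)
    moreover have "\<not> minimal_exponents C \<subset> C"
      using min eq up_set_minimal_exponents by metis
    ultimately have "minimal_exponents C = C" by blast
    then show ?thesis
      using eq minimal_exponents_up_set by metis
  qed
  ultimately show ?thesis
    unfolding min_gens_def by blast
qed

lemma gens_divide_monomial_ideal:
  assumes "\<And>b. b \<in> B \<Longrightarrow> b \<le> a"
  shows "gens_divide (monomial_ideal B :: ('n::finite, 'k::field) polyring set) a"
  using assms
  by (auto simp: gens_divide_def min_gens_monomial_ideal minimal_exponents_def intro: monom_of_dvd)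

lemma irred_ideal_eq_monomial_ideal:
  "(irred_ideal b :: ('n::finite, 'k::field) polyring set)
     = monomial_ideal {Poly_Mapping.lookup (Poly_Mapping.single i (b i)) | i. b i \<ge> 1}"
proof -
  have "(var i ^ k :: ('n, 'k) polyring) = monom_of (Poly_Mapping.lookup (Poly_Mapping.single i k))"
    for i k
    by (simp add: var_power monom_of_eq_single)
  then have "{var i ^ b i | i. b i \<ge> 1} = (monom_of ::_ \<Rightarrow> ('n, 'k) polyring)
     ` {Poly_Mapping.lookup (Poly_Mapping.single i (b i)) | i. b i \<ge> 1}"
    by auto
  then show ?thesis
    by (simp add: irred_ideal_def monomial_ideal_def)
qed

lemma mem_irred_ideal_iff:
  fixes p :: "('n::finite, 'k::field) polyring"
  shows "p \<in> irred_ideal b \<longleftrightarrow>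
    (\<forall>m\<in>Poly_Mapping.keys p. \<exists>i. b i \<ge> 1 \<and> b i \<le> Poly_Mapping.lookup m i)"
proof -
  have single_le: "Poly_Mapping.lookup (Poly_Mapping.single i k) \<le> u \<longleftrightarrow> k \<le> u i"
    for i k and u :: "'n \<Rightarrow> nat"
    by (auto simp: le_fun_def lookup_single when_def)
  have "u \<in> up_set {Poly_Mapping.lookup (Poly_Mapping.single i (b i)) | i. b i \<ge> 1} \<longleftrightarrow>
    (\<exists>i. b i \<ge> 1 \<and> Poly_Mapping.lookup (Poly_Mapping.single i (b i)) \<le> u)" for u
    unfolding up_set_def by blast
  then show ?thesis
    unfolding irred_ideal_eq_monomial_ideal mem_monomial_ideal_iff single_le by simp
qed

text \<open>Reduces a duality of ideals to exponent vectors. The condition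
  \<open>a i + 1 - b i \<le> u i\<close> is rewritten without subtraction as
  \<open>a i < u i + b i\<close>, and all of \<open>B\<close> may be used in place of the minimal
  generators.\<close>

lemma alexander_dual_monomial_ideal_eqI:
  assumes le: "\<And>b. b \<in> B \<Longrightarrow> b \<le> a"
    and dual: "\<And>u. u \<in> up_set C \<longleftrightarrow> (\<forall>b\<in>B. \<exists>i. b i \<ge> 1 \<and> a i < u i + b i)"
  shows "alexander_dual (monomial_ideal B :: ('n::finite, 'k::field) polyring set) a = monomial_ideal C"
proof -
  have compl: "(\<exists>i. exp_compl a b i \<ge> 1 \<and> exp_compl a b i \<le> u i) \<longleftrightarrow>
      (\<exists>i. b i \<ge> 1 \<and> a i < u i + b i)" if "b \<in> B" for b u
  proof -
    have "exp_compl a b i \<ge> 1 \<and> exp_compl a b i \<le> u i \<longleftrightarrow> b i \<ge> 1 \<and> a i < u i + b i" for i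
    proof -
      \<comment> \<open>This makes \<open>a i + 1 - b i\<close> at least 1, so a coordinate of
        \<open>exp_compl a b\<close> vanishes only where \<open>b i = 0\<close>.\<close>
      have "b i \<le> a i" using le[OF that] by (simp add: le_fun_def)
      then show ?thesis by (auto simp: exp_compl_def)
    qed
    then show ?thesis by blast
  qed
  \<comment> \<open>The condition on \<open>b\<close> is monotone in \<open>b\<close>: a coordinate
    that witnesses it for a minimal exponent also does so for every exponent above.\<close>
  have min: "(\<forall>b\<in>minimal_exponents B. \<exists>i. b i \<ge> 1 \<and> a i < u i + b i) \<longleftrightarrow> u \<in> up_set C" for u
    unfolding dual
  proof (intro iffI ballI)
    fix b assume *: "\<forall>b\<in>minimal_exponents B. \<exists>i. b i \<ge> 1 \<and> a i < u i + b i" and "b \<in> B"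
    then obtain c where c: "c \<in> minimal_exponents B" "c \<le> b"
      using minimal_exponents_below by blast
    then obtain i where "c i \<ge> 1" "a i < u i + c i" using * by blast
    moreover have "c i \<le> b i" using c by (simp add: le_fun_def)
    ultimately show "\<exists>i. b i \<ge> 1 \<and> a i < u i + b i" by (intro exI[of _ i]) auto
  qed (auto simp: minimal_exponents_def)
  have "p \<in> alexander_dual (monomial_ideal B) a \<longleftrightarrow> p \<in> monomial_ideal C"
    for p :: "('n, 'k) polyring"
  proof -
    have "p \<in> alexander_dual (monomial_ideal B) a \<longleftrightarrow>
      (\<forall>m\<in>Poly_Mapping.keys p. \<forall>b\<in>minimal_exponents B.
         \<exists>i. exp_compl a b i \<ge> 1 \<and> exp_compl a b i \<le> Poly_Mapping.lookup m i)"
      by (auto simp: alexander_dual_def min_gens_monomial_ideal mem_irred_ideal_iff)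
    also have "\<dots> \<longleftrightarrow> (\<forall>m\<in>Poly_Mapping.keys p. \<forall>b\<in>minimal_exponents B.
         \<exists>i. b i \<ge> 1 \<and> a i < Poly_Mapping.lookup m i + b i)"
      using compl by (intro ball_cong refl) (auto simp: minimal_exponents_def)
    finally show ?thesis unfolding min mem_monomial_ideal_iff .
  qed
  then show ?thesis by blast
qed

section \<open>Acyclic orientations and connected vertex sets\<close>

lemma simple_graph_no_loop: "simple_graph V E \<Longrightarrow> {i, i} \<notin> E"
  by (auto simp: simple_graph_def)

lemma degree_vec_eq_card_neighbours:
  assumes "simple_graph (UNIV :: 'n set) E"
  shows "degree_vec E i = card {j. {i, j} \<in> E}"
proof -
  have "bij_betw (\<lambda>j. {i, j}) {j. {i, j} \<in> E} {e\<in>E. i \<in> e}"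
    unfolding bij_betw_def
  proof
    show "inj_on (\<lambda>j. {i, j}) {j. {i, j} \<in> E}"
      by (auto simp: inj_on_def doubleton_eq_iff)
    have "\<exists>j. e = {i, j}" if "e \<in> E" "i \<in> e" for e
      using that assms by (auto simp: simple_graph_def card_2_iff)
    then show "(\<lambda>j. {i, j}) ` {j. {i, j} \<in> E} = {e\<in>E. i \<in> e}" by blast
  qed
  then show ?thesis
    by (simp add: degree_vec_def bij_betw_same_card)
qed

lemma indeg_eq_card: "indeg D i = card {j. (j, i) \<in> D}"
proof -
  have "{d\<in>D. snd d = i} = (\<lambda>j. (j, i)) ` {j. (j, i) \<in> D}" by force
  then show ?thesis
    by (simp add: indeg_def card_image inj_on_def)
qed

text \<open>Neighbours of \<open>i\<close> lie either inside or outside \<sigma>. This identity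
  translates between the bounds coming from indegrees and those coming from
  \<open>deg_out\<close>.\<close>

lemma degree_vec_eq_in_plus_out:
  fixes E :: "'n::finite set set"
  assumes "simple_graph (UNIV :: 'n set) E"
  shows "degree_vec E i = card {j\<in>\<sigma>. {i, j} \<in> E} + deg_out E \<sigma> i"
proof -
  have "{j. {i, j} \<in> E} = {j\<in>\<sigma>. {i, j} \<in> E} \<union> {j. j \<notin> \<sigma> \<and> {i, j} \<in> E}" by blast
  then show ?thesis
    unfolding degree_vec_eq_card_neighbours[OF assms] deg_out_def
    by (simp add: card_Un_disjoint disjoint_iff)
qed

lemma indeg_le_degree_vec:
  fixes E :: "'n::finite set set"
  assumes "simple_graph (UNIV :: 'n set) E" "orientation E D"
  shows "indeg D i \<le> degree_vec E i"
  unfolding indeg_eq_card degree_vec_eq_card_neighbours[OF assms(1)]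
  using assms(2) by (intro card_mono) (auto simp: orientation_def insert_commute)

lemma acyclic_orientation_sink:
  fixes E :: "'n::finite set set"
  assumes "orientation E D" "acyclic D" "\<sigma> \<noteq> {}"
  shows "\<exists>i\<in>\<sigma>. card {j\<in>\<sigma>. {i, j} \<in> E} \<le> indeg D i"
proof -
  \<comment> \<open>A minimal element of \<sigma> for the converse of \<open>D\<close> has no
    outgoing edge into \<sigma>, so all its edges within \<sigma> point towards it.\<close>
  have "wf (D\<inverse>)" using assms(2) by (intro finite_acyclic_wf_converse) auto
  then obtain i where i: "i \<in> \<sigma>" "\<And>j. (i, j) \<in> D \<Longrightarrow> j \<notin> \<sigma>"
    using assms(3) by (metis wfE_min converse_iff ex_in_conv)
  have "{j\<in>\<sigma>. {i, j} \<in> E} \<subseteq> {j. (j, i) \<in> D}"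
    using i assms(1) by (auto simp: orientation_def)
  then show ?thesis
    using i(1) by (auto simp: indeg_eq_card intro!: bexI[of _ i] card_mono)
qed

text \<open>Remove from \<open>A\<close> one vertex after another, each good for the set still
  present. The ranking \<open>f\<close> decreases along the removal, so
  \<open>{j\<in>A. f j \<le> f i}\<close> is the set present when \<open>i\<close> is removed, with
  \<open>i\<close> included.\<close>

lemma elimination_order:
  fixes P :: "'n set \<Rightarrow> 'n \<Rightarrow> bool"
  assumes "\<And>\<sigma>. \<sigma> \<noteq> {} \<Longrightarrow> \<exists>i\<in>\<sigma>. P \<sigma> i" "finite A"
  shows "\<exists>f :: 'n \<Rightarrow> nat. inj_on f A \<and> (\<forall>i\<in>A. P {j\<in>A. f j \<le> f i} i)"
  using assms(2)
proof (induction "card A" arbitrary: A)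
  case 0
  then show ?case by auto
next
  case (Suc n)
  then have "A \<noteq> {}" by auto
  then obtain a where a: "a \<in> A" "P A a" using assms(1) by blast
  have "n = card (A - {a})" using Suc(2,3) a(1) by simp
  then obtain f :: "'n \<Rightarrow> nat" where f: "inj_on f (A - {a})"
      "\<forall>i\<in>A - {a}. P {j\<in>A - {a}. f j \<le> f i} i"
    using Suc(1)[of "A - {a}"] Suc(3) by blast
  \<comment> \<open>The vertex \<open>a\<close> is removed first and gets a rank above all others:
    its set is all of \<open>A\<close>, and \<open>a\<close> enters none of the other sets.\<close>
  define N where "N = Suc (Max (f ` A))"
  have N: "f j < N" if "j \<in> A" for j
    unfolding N_def using that Suc(3) by (simp add: less_Suc_eq_le)
  define g where "g = f(a := N)"
  have "inj_on g A"
  proof (rule inj_onI)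
    fix x y assume "x \<in> A" "y \<in> A" "g x = g y"
    then show "x = y"
      using N[of x] N[of y] inj_onD[OF f(1), of x y] by (auto simp: g_def split: if_splits)
  qed
  moreover have "P {j\<in>A. g j \<le> g i} i" if "i \<in> A" for i
  proof (cases "i = a")
    case True
    have "{j\<in>A. g j \<le> g a} = A" using N by (auto simp: g_def less_imp_le)
    then show ?thesis using True a by simp
  next
    case False
    have "{j\<in>A. g j \<le> g i} = {j\<in>A - {a}. f j \<le> f i}"
      using False N[OF that] by (auto simp: g_def)
    then show ?thesis using f(2) False that by simp
  qed
  ultimately show ?case by blast
qed

text \<open>Orienting edges towards the higher rank makes the in-neighbours of \<open>i\<close>
  exactly its neighbours still present when \<open>i\<close> is removed. Ranks increase along edges,
  which excludes cycles. The predicate \<open>P\<close> is left general so that both dualities can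
  use the lemma.\<close>

lemma exists_acyclic_orientation:
  fixes E :: "'n::finite set set"
  assumes E: "simple_graph (UNIV :: 'n set) E"
    and P: "\<And>\<sigma>. \<sigma> \<noteq> {} \<Longrightarrow> \<exists>i\<in>\<sigma>. P i (card {j\<in>\<sigma>. {i, j} \<in> E})"
  shows "\<exists>D. orientation E D \<and> acyclic D \<and> (\<forall>i. P i (indeg D i))"
proof -
  obtain f :: "'n \<Rightarrow> nat" where f: "inj f"
      "\<And>i. P i (card {j\<in>{j. f j \<le> f i}. {i, j} \<in> E})"
    using elimination_order[of "\<lambda>\<sigma> i. P i (card {j\<in>\<sigma>. {i, j} \<in> E})" UNIV] P by auto
  define D where "D = {(i, j). {i, j} \<in> E \<and> f i < f j}"
  \<comment> \<open>The endpoints of an edge are distinct and \<open>f\<close> is injective, so no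
    ties occur along edges.\<close>
  have less_iff: "f i < f j \<longleftrightarrow> f i \<le> f j" if "{i, j} \<in> E" for i j
    using that simple_graph_no_loop[OF E] injD[OF f(1)] by (metis le_neq_implies_less less_imp_le)
  have "orientation E D"
    unfolding orientation_def D_def using less_iff
    by (auto simp: insert_commute) (metis linorder_le_cases not_less)+
  moreover have "acyclic D"
    by (rule wf_acyclic, rule wf_subset[OF wf_measure[of f]]) (auto simp: D_def)
  moreover have "{j. (j, i) \<in> D} = {j\<in>{j. f j \<le> f i}. {i, j} \<in> E}" for i
    unfolding D_def using less_iff by (auto simp: insert_commute)
  ultimately show ?thesis
    using f(2) by (metis indeg_eq_card)
qed

text \<open>Take a connected component of the graph induced on \<sigma>: it contains all neighbours
  in \<sigma> of its vertices. Elimination needs a good vertex in every nonempty set, while the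
  generators of \<open>T_ideal\<close> provide one only for connected sets; a component closes this
  gap.\<close>

lemma connected_component_subset:
  fixes E :: "'n set set"
  assumes "\<sigma> \<noteq> {}"
  shows "\<exists>\<tau>\<subseteq>\<sigma>. \<tau> \<noteq> {} \<and> connected_graph \<tau> (induced_edges E \<tau>) \<and>
    (\<forall>i\<in>\<tau>. {j\<in>\<tau>. {i, j} \<in> E} = {j\<in>\<sigma>. {i, j} \<in> E})"
proof -
  obtain a where a: "a \<in> \<sigma>" using assms by blast
  define R where "R = {(i, j). {i, j} \<in> induced_edges E \<sigma>}"
  define \<tau> where "\<tau> = {j. (a, j) \<in> R\<^sup>*}"
  define R' where "R' = {(i, j). {i, j} \<in> induced_edges E \<tau>}"
  have "sym R'" by (auto simp: R'_def sym_def insert_commute)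
  have "j \<in> \<sigma>" if "(a, j) \<in> R\<^sup>*" for j
    using that a by (induction rule: rtrancl_induct) (auto simp: R_def induced_edges_def)
  then have sub: "\<tau> \<subseteq> \<sigma>" by (auto simp: \<tau>_def)
  have closed: "j \<in> \<tau>" if "i \<in> \<tau>" "j \<in> \<sigma>" "{i, j} \<in> E" for i j
  proof -
    have "(i, j) \<in> R" using that sub by (auto simp: R_def induced_edges_def)
    then show ?thesis using that(1) by (auto simp: \<tau>_def intro: rtrancl_into_rtrancl)
  qed
  \<comment> \<open>A path from \<open>a\<close> within \<sigma> visits only vertices of the
    component \<tau>, so it is also a path in the graph induced on \<tau>.\<close>
  have reach: "(a, j) \<in> R'\<^sup>*" if "(a, j) \<in> R\<^sup>*" for j
    using that
  proof (induction rule: rtrancl_induct)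
    case (step y z)
    have "y \<in> \<tau>" "z \<in> \<tau>" using step(1,2) by (auto simp: \<tau>_def intro: rtrancl_into_rtrancl)
    then have "(y, z) \<in> R'" using step(2) by (auto simp: R_def R'_def induced_edges_def)
    then show ?case using step(3) by (rule rtrancl_into_rtrancl[rotated])
  qed simp
  have "(u, v) \<in> R'\<^sup>*" if "u \<in> \<tau>" "v \<in> \<tau>" for u v
  proof -
    have "(a, u) \<in> R'\<^sup>*" "(a, v) \<in> R'\<^sup>*" using that reach by (auto simp: \<tau>_def)
    moreover have "(u, a) \<in> R'\<^sup>*"
      using \<open>(a, u) \<in> R'\<^sup>*\<close> \<open>sym R'\<close> by (metis sym_rtrancl symD)
    ultimately show ?thesis by (metis rtrancl_trans)
  qed
  moreover have "a \<in> \<tau>" by (simp add: \<tau>_def)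
  ultimately have "\<tau> \<noteq> {} \<and> connected_graph \<tau> (induced_edges E \<tau>)"
    unfolding connected_graph_def R'_def by blast
  moreover have "\<forall>i\<in>\<tau>. {j\<in>\<tau>. {i, j} \<in> E} = {j\<in>\<sigma>. {i, j} \<in> E}"
    using closed sub by blast
  ultimately show ?thesis using sub by blast
qed

section \<open>The duality\<close>

definition A_exponents :: "'n set set \<Rightarrow> ('n \<Rightarrow> nat) set" where
  "A_exponents E = {\<lambda>i. indeg D i + 1 | D. orientation E D \<and> acyclic D}"

definition T_exponents :: "'n set set \<Rightarrow> ('n \<Rightarrow> nat) set" where
  "T_exponents E = {\<lambda>i. if i \<in> \<sigma> then deg_out E \<sigma> i + 1 else 0 | \<sigma>.
     \<sigma> \<noteq> {} \<and> connected_graph \<sigma> (induced_edges E \<sigma>)}"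

text \<open>For \<open>b i = indeg D i + 1\<close> the inequality says that the outdegree of
  \<open>i\<close> in \<open>D\<close> is less than \<open>u i\<close>.\<close>

lemma T_exponents_dual_A_exponents:
  fixes E :: "'n::finite set set"
  assumes E: "simple_graph (UNIV :: 'n set) E"
  shows "u \<in> up_set (T_exponents E) \<longleftrightarrow>
    (\<forall>b\<in>A_exponents E. \<exists>i. b i \<ge> 1 \<and> degree_vec E i + 1 < u i + b i)"
proof (intro iffI ballI)
  fix b assume "u \<in> up_set (T_exponents E)" "b \<in> A_exponents E"
  then obtain \<sigma> D where \<sigma>: "\<sigma> \<noteq> {}"
      "(\<lambda>i. if i \<in> \<sigma> then deg_out E \<sigma> i + 1 else 0) \<le> u"
    and D: "orientation E D" "acyclic D" and b: "b = (\<lambda>i. indeg D i + 1)"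
    by (auto simp: up_set_def T_exponents_def A_exponents_def)
  obtain i where i: "i \<in> \<sigma>" "card {j\<in>\<sigma>. {i, j} \<in> E} \<le> indeg D i"
    using acyclic_orientation_sink[OF D \<sigma>(1)] by blast
  have "deg_out E \<sigma> i + 1 \<le> u i"
    using \<sigma>(2) i(1) by (auto simp: le_fun_def dest: spec[of _ i])
  then show "\<exists>i. b i \<ge> 1 \<and> degree_vec E i + 1 < u i + b i"
    using i(2) degree_vec_eq_in_plus_out[OF E, of i \<sigma>] by (intro exI[of _ i]) (simp add: b)
next
  assume *: "\<forall>b\<in>A_exponents E. \<exists>i. b i \<ge> 1 \<and> degree_vec E i + 1 < u i + b i"
  show "u \<in> up_set (T_exponents E)"
  proof (rule ccontr)
    assume u: "u \<notin> up_set (T_exponents E)"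
    \<comment> \<open>A vertex is good for \<sigma> if \<open>u i\<close> is at most its degree
      minus its number of neighbours in \<sigma>. The resulting orientation has all outdegrees at
      least \<open>u i\<close>, against the assumption.\<close>
    have "\<exists>i\<in>\<sigma>. u i + card {j\<in>\<sigma>. {i, j} \<in> E} \<le> degree_vec E i" if "\<sigma> \<noteq> {}" for \<sigma>
    proof -
      obtain \<tau> where \<tau>: "\<tau> \<subseteq> \<sigma>" "\<tau> \<noteq> {}" "connected_graph \<tau> (induced_edges E \<tau>)"
          "\<forall>i\<in>\<tau>. {j\<in>\<tau>. {i, j} \<in> E} = {j\<in>\<sigma>. {i, j} \<in> E}"
        using connected_component_subset[OF \<open>\<sigma> \<noteq> {}\<close>, of E]
        by (elim exE conjE) (rule that)
      then have "(\<lambda>i. if i \<in> \<tau> then deg_out E \<tau> i + 1 else 0) \<in> T_exponents E"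
        unfolding T_exponents_def by blast
      then have "\<not> (\<lambda>i. if i \<in> \<tau> then deg_out E \<tau> i + 1 else 0) \<le> u"
        using u unfolding up_set_def by blast
      then obtain i where i: "i \<in> \<tau>" "u i \<le> deg_out E \<tau> i"
        by (auto simp: le_fun_def not_le split: if_splits)
      \<comment> \<open>The bound by \<open>deg_out E \<tau> i\<close> carries over to \<sigma>
        because \<open>i\<close> has the same neighbours in \<tau> as in \<sigma>.\<close>
      then show ?thesis
        using \<tau> degree_vec_eq_in_plus_out[OF E, of i \<tau>] by (intro bexI[of _ i]) auto
    qed
    from exists_acyclic_orientation[OF E this] obtain D where
      D: "orientation E D" "acyclic D" "\<And>i. u i + indeg D i \<le> degree_vec E i" by blast
    then have "(\<lambda>i. indeg D i + 1) \<in> A_exponents E" by (auto simp: A_exponents_def)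
    from bspec[OF * this] obtain i where "degree_vec E i + 1 < u i + (indeg D i + 1)" by auto
    with D(3)[of i] show False by simp
  qed
qed

text \<open>Here \<open>b i \<ge> 1\<close> forces \<open>i\<close> to lie in \<sigma>, and with
  \<open>b i = deg_out E \<sigma> i + 1\<close> the inequality says that \<open>i\<close> has fewer
  than \<open>u i\<close> neighbours in \<sigma>.\<close>

lemma A_exponents_dual_T_exponents:
  fixes E :: "'n::finite set set"
  assumes E: "simple_graph (UNIV :: 'n set) E"
  shows "u \<in> up_set (A_exponents E) \<longleftrightarrow>
    (\<forall>b\<in>T_exponents E. \<exists>i. b i \<ge> 1 \<and> degree_vec E i + 1 < u i + b i)"
proof (intro iffI ballI)
  fix b assume "u \<in> up_set (A_exponents E)" "b \<in> T_exponents E"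
  then obtain \<sigma> D where \<sigma>: "\<sigma> \<noteq> {}" "b = (\<lambda>i. if i \<in> \<sigma> then deg_out E \<sigma> i + 1 else 0)"
    and D: "orientation E D" "acyclic D" and u: "(\<lambda>i. indeg D i + 1) \<le> u"
    by (auto simp: up_set_def T_exponents_def A_exponents_def)
  obtain i where i: "i \<in> \<sigma>" "card {j\<in>\<sigma>. {i, j} \<in> E} \<le> indeg D i"
    using acyclic_orientation_sink[OF D \<sigma>(1)] by blast
  have "indeg D i + 1 \<le> u i"
    using u by (auto simp: le_fun_def)
  then show "\<exists>i. b i \<ge> 1 \<and> degree_vec E i + 1 < u i + b i"
    using i degree_vec_eq_in_plus_out[OF E, of i \<sigma>] by (intro exI[of _ i]) (simp add: \<sigma>(2))
next
  assume *: "\<forall>b\<in>T_exponents E. \<exists>i. b i \<ge> 1 \<and> degree_vec E i + 1 < u i + b i"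
  \<comment> \<open>This time goodness bounds the neighbours in \<sigma>, hence the indegrees of the
    resulting orientation, whose generator then lies below \<open>u\<close>.\<close>
  have "\<exists>i\<in>\<sigma>. card {j\<in>\<sigma>. {i, j} \<in> E} + 1 \<le> u i" if "\<sigma> \<noteq> {}" for \<sigma>
  proof -
    obtain \<tau> where \<tau>: "\<tau> \<subseteq> \<sigma>" "\<tau> \<noteq> {}" "connected_graph \<tau> (induced_edges E \<tau>)"
        "\<forall>i\<in>\<tau>. {j\<in>\<tau>. {i, j} \<in> E} = {j\<in>\<sigma>. {i, j} \<in> E}"
      using connected_component_subset[OF \<open>\<sigma> \<noteq> {}\<close>, of E]
        by (elim exE conjE) (rule that)
    then have "(\<lambda>i. if i \<in> \<tau> then deg_out E \<tau> i + 1 else 0) \<in> T_exponents E"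
      unfolding T_exponents_def by blast
    from bspec[OF * this] obtain i
      where i: "i \<in> \<tau>" "degree_vec E i + 1 < u i + (deg_out E \<tau> i + 1)"
      by (auto split: if_splits)
    then show ?thesis
      using \<tau> degree_vec_eq_in_plus_out[OF E, of i \<tau>] by (intro bexI[of _ i]) auto
  qed
  from exists_acyclic_orientation[OF E this] obtain D where
    D: "orientation E D" "acyclic D" "\<forall>i. indeg D i + 1 \<le> u i" by blast
  then have "(\<lambda>i. indeg D i + 1) \<in> A_exponents E" "(\<lambda>i. indeg D i + 1) \<le> u"
    by (auto simp: A_exponents_def le_fun_def)
  then show "u \<in> up_set (A_exponents E)"
    unfolding up_set_def by blast
qed

text \<open>The \<open>gens_divide\<close> conjuncts certify that both duals are taken where
  \<open>alexander_dual\<close> is meaningful; they hold because \<open>indeg\<close> and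
  \<open>deg_out\<close> are bounded by the degree.\<close>

theorem theorem3p6:
  fixes E :: "'n::finite set set"
  assumes "infinite (UNIV :: 'k::field set)"
    and "simple_graph (UNIV :: 'n set) E"
    and "connected_graph (UNIV :: 'n set) E"
  shows "gens_divide (A_ideal E :: ('n, 'k) polyring set) (\<lambda>i. degree_vec E i + 1) \<and>
         gens_divide (T_ideal E :: ('n, 'k) polyring set) (\<lambda>i. degree_vec E i + 1) \<and>
         alexander_dual (A_ideal E :: ('n, 'k) polyring set) (\<lambda>i. degree_vec E i + 1) = T_ideal E \<and>
         alexander_dual (T_ideal E :: ('n, 'k) polyring set) (\<lambda>i. degree_vec E i + 1) = A_ideal E"
proof -
  let ?a = "\<lambda>i. degree_vec E i + 1"
  note E = assms(2)
  have A: "b \<le> ?a" if "b \<in> A_exponents E" for b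
    using that indeg_le_degree_vec[OF E] by (auto simp: A_exponents_def le_fun_def)
  have T: "b \<le> ?a" if "b \<in> T_exponents E" for b
  proof -
    have "deg_out E \<sigma> i \<le> degree_vec E i" for \<sigma> i
      using degree_vec_eq_in_plus_out[OF E, of i \<sigma>] by simp
    then show ?thesis using that by (auto simp: T_exponents_def le_fun_def split: if_splits)
  qed
  show ?thesis
    unfolding A_ideal_def T_ideal_def
    unfolding A_exponents_def[symmetric] T_exponents_def[symmetric]
    using gens_divide_monomial_ideal[OF A] gens_divide_monomial_ideal[OF T]
      alexander_dual_monomial_ideal_eqI[OF A T_exponents_dual_A_exponents[OF E]]
      alexander_dual_monomial_ideal_eqI[OF T A_exponents_dual_T_exponents[OF E]]
    by blast
qed

end
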